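(* (i) The linear map $d$ with $d(e_i)=e_i$ for $i\ge 2$ is an outer derivation of the Lie algebra $R_1(\mathfrak{m}_0,1,\beta)$. (ii) For the Lie algebra $R_2(\mathfrak{m}_0,1,\beta)$: if $\beta_2=1$, the linear map $d$ with $d(e_1)=e_2$, $d(x)=\sum_{i=2}^{t-1}\beta_{i+1}e_i$ is an outer derivation; if $\beta_2\ne 1$, the linear map $d$ with $d(e_1)=\frac{\alpha_2}{\beta_2-1}e_2$, $d(e_i)=e_i$ for $i\ge 2$, $d(x)=\sum_{i=2}^{t-1}\frac{\alpha_2\beta_{i+1}}{\beta_2-1}e_i$ is an outer derivation. (iii) The linear map $d$ with $d(e_i)=e_{i+2}$ for $i\ge 2$ is an outer derivation of the Lie algebra $R_3(\mathfrak{m}_0,1,\beta)$. In each case $d$ is zero on the basis vectors for which no value is listed.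
   Context: All algebras are over $\mathbb{C}$, with the countable basis $\{x,e_1,e_2,\dots\}$, every element being a finite linear combination of basis elements. Products of basis elements that are neither listed nor obtained from listed ones by antisymmetry are zero; empty sums are zero. The Lie algebras are: $R_1(\mathfrak{m}_0,1,\beta)$, with $\beta=(\beta_3,\dots,\beta_t)\in\mathbb{C}^{t-2}$, $t\in\mathbb{N}$: $[e_i,e_1]=e_{i+1}$ ($i\ge 2$), $[e_1,x]=e_1$, $[e_i,x]=(i-2)e_i+\sum_{k=3}^{t}\beta_k e_{i+k-2}$ ($i\ge 2$). $R_2(\mathfrak{m}_0,1,\beta)$, with $\alpha_2\in\mathbb{C}$, $\beta=(\beta_2,\beta_3,\dots,\beta_t)\in\mathbb{C}^{t-1}$, $t\in\mathbb{N}$: $[e_i,e_1]=e_{i+1}$ ($i\ge 2$), $[e_1,x]=e_1+\alpha_2e_2$, $[e_i,x]=((i-2)+\beta_2)e_i+\sum_{k=3}^{t}\beta_k e_{i+k-2}$ ($i\ge 2$). $R_3(\mathfrak{m}_0,1,\beta)$, with $\beta=(\beta_3,\dots,\beta_t)\in\mathbb{C}^{t-2}$, $t\in\mathbb{N}$: $[e_i,e_1]=e_{i+1}$ ($i\ge 2$), $[e_i,x]=e_i+\sum_{k=3}^{t}\beta_k e_{i+k-2}$ ($i\ge 2$). A derivation is a linear map $d$ with $d([a,b])=[d(a),b]+[a,d(b)]$; it is inner if it equals $b\mapsto[a,b]$ for some element $a$, and outer if it is not inner. *)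

theory Defs
  imports Complex_Main "HOL-Library.Poly_Mapping"
begin

subsection \<open>Lie algebras and derivations\<close>

locale lie_algebra = vector_space scale
  for scale :: "'a::field \<Rightarrow> 'b::ab_group_add \<Rightarrow> 'b" +
  fixes bracket :: "'b \<Rightarrow> 'b \<Rightarrow> 'b"
  assumes bracket_linear_left: "Vector_Spaces.linear scale scale (\<lambda>a. bracket a b)"
    and bracket_linear_right: "Vector_Spaces.linear scale scale (\<lambda>b. bracket a b)"
    and bracket_self: "bracket a a = 0"
    and jacobi: "bracket a (bracket b c) + bracket b (bracket c a) + bracket c (bracket a b) = 0"
begin

definition derivation :: "('b \<Rightarrow> 'b) \<Rightarrow> bool" where
  "derivation d \<longleftrightarrow> Vector_Spaces.linear scale scale d \<and>
     (\<forall>a b. d (bracket a b) = bracket (d a) b + bracket a (d b))"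

definition inner_derivation :: "('b \<Rightarrow> 'b) \<Rightarrow> bool" where
  "inner_derivation d \<longleftrightarrow> derivation d \<and> (\<exists>a. \<forall>b. d b = bracket a b)"

definition outer_derivation :: "('b \<Rightarrow> 'b) \<Rightarrow> bool" where
  "outer_derivation d \<longleftrightarrow> derivation d \<and> \<not> inner_derivation d"

end


subsection \<open>The vector space with basis x, e1, e2, ...\<close>

text \<open>
  Vectors are finitely supported coefficient families indexed by \<open>nat\<close>: the index \<open>0\<close> stands
  for the basis vector \<open>x\<close>, and an index \<open>i \<ge> 1\<close> stands for \<open>e\<^sub>i\<close>.
\<close>

type_synonym vec = "nat \<Rightarrow>\<^sub>0 complex"

definition bvec :: "nat \<Rightarrow> vec" where
  "bvec i = Poly_Mapping.single i 1"

definition cscale :: "complex \<Rightarrow> vec \<Rightarrow> vec" where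
  "cscale c u = Poly_Mapping.map ((*) c) u"

text \<open>The unique linear map with prescribed values \<open>\<phi> i\<close> on the basis vectors \<open>bvec i\<close>.\<close>

definition linear_extension :: "(nat \<Rightarrow> vec) \<Rightarrow> vec \<Rightarrow> vec" where
  "linear_extension \<phi> u = (\<Sum>i\<in>Poly_Mapping.keys u. cscale (Poly_Mapping.lookup u i) (\<phi> i))"

text \<open>
  The bilinear bracket determined by a table \<open>L\<close> of listed products of basis vectors.  As no
  product is listed in both orders, \<open>L i j - L j i\<close> is the listed product, or the one obtained
  from it by antisymmetry, or zero.
\<close>

definition table_bracket :: "(nat \<Rightarrow> nat \<Rightarrow> vec) \<Rightarrow> vec \<Rightarrow> vec \<Rightarrow> vec" where
  "table_bracket L u v =
     linear_extension (\<lambda>i. linear_extension (\<lambda>j. L i j - L j i) v) u"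


subsection \<open>The three families\<close>

text \<open>
  A parameter tuple \<open>\<beta>\<close> is a function of which only the entries with indices \<open>3..t\<close> (for the
  second family \<open>2..t\<close>) are used.
\<close>

definition R1_table :: "nat \<Rightarrow> (nat \<Rightarrow> complex) \<Rightarrow> nat \<Rightarrow> nat \<Rightarrow> vec" where
  "R1_table t \<beta> i j =
     (if i \<ge> 2 \<and> j = 1 then bvec (i + 1)
      else if i = 1 \<and> j = 0 then bvec 1
      else if i \<ge> 2 \<and> j = 0 then
        cscale (of_nat i - 2) (bvec i) + (\<Sum>k = 3..t. cscale (\<beta> k) (bvec (i + k - 2)))
      else 0)"

definition R2_table :: "nat \<Rightarrow> complex \<Rightarrow> (nat \<Rightarrow> complex) \<Rightarrow> nat \<Rightarrow> nat \<Rightarrow> vec" where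
  "R2_table t \<alpha>2 \<beta> i j =
     (if i \<ge> 2 \<and> j = 1 then bvec (i + 1)
      else if i = 1 \<and> j = 0 then bvec 1 + cscale \<alpha>2 (bvec 2)
      else if i \<ge> 2 \<and> j = 0 then
        cscale ((of_nat i - 2) + \<beta> 2) (bvec i)
          + (\<Sum>k = 3..t. cscale (\<beta> k) (bvec (i + k - 2)))
      else 0)"

definition R3_table :: "nat \<Rightarrow> (nat \<Rightarrow> complex) \<Rightarrow> nat \<Rightarrow> nat \<Rightarrow> vec" where
  "R3_table t \<beta> i j =
     (if i \<ge> 2 \<and> j = 1 then bvec (i + 1)
      else if i \<ge> 2 \<and> j = 0 then
        bvec i + (\<Sum>k = 3..t. cscale (\<beta> k) (bvec (i + k - 2)))
      else 0)"

abbreviation R1_bracket :: "nat \<Rightarrow> (nat \<Rightarrow> complex) \<Rightarrow> vec \<Rightarrow> vec \<Rightarrow> vec" where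
  "R1_bracket t \<beta> \<equiv> table_bracket (R1_table t \<beta>)"

abbreviation R2_bracket :: "nat \<Rightarrow> complex \<Rightarrow> (nat \<Rightarrow> complex) \<Rightarrow> vec \<Rightarrow> vec \<Rightarrow> vec" where
  "R2_bracket t \<alpha>2 \<beta> \<equiv> table_bracket (R2_table t \<alpha>2 \<beta>)"

abbreviation R3_bracket :: "nat \<Rightarrow> (nat \<Rightarrow> complex) \<Rightarrow> vec \<Rightarrow> vec \<Rightarrow> vec" where
  "R3_bracket t \<beta> \<equiv> table_bracket (R3_table t \<beta>)"


subsection \<open>The brackets are Lie brackets\<close>

lemma lookup_cscale [simp]: "Poly_Mapping.lookup (cscale c u) i = c * Poly_Mapping.lookup u i"
  unfolding cscale_def by (simp add: Poly_Mapping.map.rep_eq when_def)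

lemma vector_space_cscale: "vector_space cscale"
  by unfold_locales (auto intro!: poly_mapping_eqI simp: lookup_add algebra_simps)

interpretation cvs: vector_space cscale
  by (rule vector_space_cscale)

lemma linear_extension_superset:
  assumes "finite A" "Poly_Mapping.keys u \<subseteq> A"
  shows "linear_extension \<phi> u = (\<Sum>i\<in>A. cscale (Poly_Mapping.lookup u i) (\<phi> i))"
  unfolding linear_extension_def
  by (rule sum.mono_neutral_left) (use assms in \<open>auto simp: in_keys_iff\<close>)

lemma linear_linear_extension: "Vector_Spaces.linear cscale cscale (linear_extension \<phi>)"
proof (unfold Vector_Spaces.linear_iff, intro conjI allI)
  fix u v :: vec and c :: complex
  let ?A = "Poly_Mapping.keys u \<union> Poly_Mapping.keys v"
  have "Poly_Mapping.keys (u + v) \<subseteq> ?A" by (rule keys_add)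
  then show "linear_extension \<phi> (u + v) = linear_extension \<phi> u + linear_extension \<phi> v"
    by (simp add: linear_extension_superset[of ?A] lookup_add cvs.scale_left_distrib sum.distrib)
  have "Poly_Mapping.keys (cscale c u) \<subseteq> Poly_Mapping.keys u"
    by (auto simp: in_keys_iff)
  then show "linear_extension \<phi> (cscale c u) = cscale c (linear_extension \<phi> u)"
    by (simp add: linear_extension_superset[of "Poly_Mapping.keys u"] cvs.scale_sum_right)
qed (rule vector_space_cscale)+

lemma linear_extension_bvec [simp]: "linear_extension \<phi> (bvec i) = \<phi> i"
  by (simp add: linear_extension_def bvec_def)

lemma vec_expansion: "u = linear_extension bvec u"
proof (rule poly_mapping_eqI)
  fix k
  show "Poly_Mapping.lookup u k = Poly_Mapping.lookup (linear_extension bvec u) k"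
    by (auto simp: linear_extension_def lookup_sum bvec_def lookup_single when_def in_keys_iff
        if_distrib cong: if_cong)
qed

lemma linear_extension_unique:
  assumes "Vector_Spaces.linear cscale cscale d" "\<And>i. d (bvec i) = \<phi> i"
  shows "d = linear_extension \<phi>"
proof
  fix u
  interpret d: Vector_Spaces.linear cscale cscale d by fact
  have "d u = d (linear_extension bvec u)"
    by (rule arg_cong[where f = d]) (rule vec_expansion)
  also have "\<dots> = linear_extension \<phi> u"
    by (simp add: linear_extension_def d.sum d.scale assms(2))
  finally show "d u = linear_extension \<phi> u" .
qed

lemma linear_eq_0:
  assumes "Vector_Spaces.linear cscale cscale d" "\<And>i. d (bvec i) = 0"
  shows "d u = 0"
  using linear_extension_unique[OF assms] by (simp add: linear_extension_def)

lemma linear_extension_add: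
  "linear_extension (\<lambda>i. \<phi> i + \<psi> i) u = linear_extension \<phi> u + linear_extension \<psi> u"
  by (simp add: linear_extension_def cvs.scale_right_distrib sum.distrib)

lemma linear_extension_scale:
  "linear_extension (\<lambda>i. cscale c (\<phi> i)) u = cscale c (linear_extension \<phi> u)"
  by (simp add: linear_extension_def cvs.scale_sum_right mult.commute)

lemma table_bracket_linear_left:
  "Vector_Spaces.linear cscale cscale (\<lambda>u. table_bracket L u v)"
  unfolding table_bracket_def by (rule linear_linear_extension)

lemma table_bracket_linear_right:
  "Vector_Spaces.linear cscale cscale (\<lambda>v. table_bracket L u v)"
proof -
  interpret V: Vector_Spaces.linear cscale cscale "linear_extension \<phi>" for \<phi>
    by (rule linear_linear_extension)
  show ?thesis
    by (auto simp: table_bracket_def Vector_Spaces.linear_iff vector_space_cscale V.add V.scale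
        linear_extension_add linear_extension_scale)
qed

lemma table_bracket_bvec: "table_bracket L (bvec i) (bvec j) = L i j - L j i"
  by (simp add: table_bracket_def)

lemmas table_bracket_simps =
  Modules.module_hom.add[OF table_bracket_linear_left[folded module_hom_iff_linear]]
  Modules.module_hom.add[OF table_bracket_linear_right[folded module_hom_iff_linear]]
  Modules.module_hom.diff[OF table_bracket_linear_left[folded module_hom_iff_linear]]
  Modules.module_hom.diff[OF table_bracket_linear_right[folded module_hom_iff_linear]]
  Modules.module_hom.neg[OF table_bracket_linear_left[folded module_hom_iff_linear]]
  Modules.module_hom.neg[OF table_bracket_linear_right[folded module_hom_iff_linear]]
  Modules.module_hom.scale[OF table_bracket_linear_left[folded module_hom_iff_linear]]
  Modules.module_hom.scale[OF table_bracket_linear_right[folded module_hom_iff_linear]]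
  Modules.module_hom.sum[OF table_bracket_linear_left[folded module_hom_iff_linear]]
  Modules.module_hom.sum[OF table_bracket_linear_right[folded module_hom_iff_linear]]
  Modules.module_hom.zero[OF table_bracket_linear_left[folded module_hom_iff_linear]]
  Modules.module_hom.zero[OF table_bracket_linear_right[folded module_hom_iff_linear]]

lemma table_bracket_swap: "table_bracket L u v = - table_bracket L v u"
proof -
  have lin: "Vector_Spaces.linear cscale cscale (\<lambda>u. table_bracket L u v + table_bracket L v u)" for v
    by (simp only: Vector_Spaces.linear_iff vector_space_cscale table_bracket_simps
        cvs.scale_right_distrib ac_simps simp_thms)
  have "table_bracket L u (bvec j) + table_bracket L (bvec j) u = 0" for u j
    by (rule linear_eq_0[OF lin]) (simp add: table_bracket_bvec)
  then have "table_bracket L (bvec j) v + table_bracket L v (bvec j) = 0" for v j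
    by (subst add.commute)
  then have "table_bracket L u v + table_bracket L v u = 0"
    by (rule linear_eq_0[OF lin])
  then show ?thesis by (rule eq_neg_iff_add_eq_0[THEN iffD2])
qed

lemma table_bracket_self: "table_bracket L u u = 0"
proof (rule poly_mapping_eqI)
  fix k
  have "Poly_Mapping.lookup (table_bracket L u u) k = - Poly_Mapping.lookup (table_bracket L u u) k"
    by (metis table_bracket_swap lookup_uminus)
  then show "Poly_Mapping.lookup (table_bracket L u u) k = Poly_Mapping.lookup 0 k" by simp
qed

lemma lie_algebra_table_bracket:
  fixes L
  defines "V \<equiv> table_bracket L"
  assumes "\<And>i j k. V (bvec i) (V (bvec j) (bvec k)) + V (bvec j) (V (bvec k) (bvec i))
             + V (bvec k) (V (bvec i) (bvec j)) = 0"
  shows "lie_algebra cscale V"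
proof -
  have lin: "Vector_Spaces.linear cscale cscale (\<lambda>a. V a (V b c) + V b (V c a) + V c (V a b))"
    for b c
    by (simp only: Vector_Spaces.linear_iff vector_space_cscale V_def table_bracket_simps
        cvs.scale_right_distrib ac_simps simp_thms)
  have 1: "V a (V (bvec j) (bvec k)) + V (bvec j) (V (bvec k) a) + V (bvec k) (V a (bvec j)) = 0"
    for a j k
    by (rule linear_eq_0[OF lin]) (rule assms)
  have 2: "V b (V (bvec k) a) + V (bvec k) (V a b) + V a (V b (bvec k)) = 0" for a b k
    by (rule linear_eq_0[OF lin]) (use 1[of a _ k] in \<open>simp only: ac_simps\<close>)
  have 3: "V c (V a b) + V a (V b c) + V b (V c a) = 0" for a b c
    by (rule linear_eq_0[OF lin]) (use 2[of b _ a] in \<open>simp only: ac_simps\<close>)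
  show ?thesis
    by (intro lie_algebra.intro lie_algebra_axioms.intro vector_space_cscale)
      (use 3 in \<open>simp_all add: V_def table_bracket_linear_left table_bracket_linear_right
        table_bracket_self ac_simps\<close>)
qed

text \<open>A common form of the three tables.\<close>

lemma lie_algebra_general_table:
  fixes \<mu> \<beta> :: "nat \<Rightarrow> complex" and c \<alpha> :: complex
  assumes tab: "L = (\<lambda>i j. if i \<ge> 2 \<and> j = 1 then bvec (i + 1)
      else if i = 1 \<and> j = 0 then cscale c (bvec 1) + cscale \<alpha> (bvec 2)
      else if i \<ge> 2 \<and> j = 0 then
        cscale (\<mu> i) (bvec i) + (\<Sum>k = 3..t. cscale (\<beta> k) (bvec (i + k - 2)))
      else 0)"
    and step: "\<And>i. i \<ge> 2 \<Longrightarrow> \<mu> (i + 1) = \<mu> i + c"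
  shows "lie_algebra cscale (table_bracket L)"
proof (rule lie_algebra_table_bracket)
  define V where "V = table_bracket L"
  define S where "S i = (\<Sum>k = 3..t. cscale (\<beta> k) (bvec (i + k - 2)))" for i
  note V_simps = table_bracket_simps[of L, folded V_def]
  have sw: "V u v = - V v u" for u v unfolding V_def by (rule table_bracket_swap)
  have i1: "V (bvec i) (bvec 1) = bvec (i + 1)" if "i \<ge> 2" for i
    using that by (simp add: V_def table_bracket_bvec tab)
  have i0: "V (bvec i) (bvec 0) = cscale (\<mu> i) (bvec i) + S i" if "i \<ge> 2" for i
    using that by (simp add: V_def table_bracket_bvec tab S_def)
  have ij: "V (bvec i) (bvec j) = 0" if "i \<ge> 2" "j \<ge> 2" for i j
    using that by (simp add: V_def table_bracket_bvec tab)
  have v10: "V (bvec 1) (bvec 0) = cscale c (bvec 1) + cscale \<alpha> (bvec 2)"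
    by (simp add: V_def table_bracket_bvec tab)
  have S1: "V (S i) (bvec 1) = S (i + 1)" if "i \<ge> 2" for i
    unfolding S_def V_simps
  proof (rule sum.cong)
    fix k assume "k \<in> {3..t}"
    with that have "i + k - 2 \<ge> 2" "i + k - 2 + 1 = i + 1 + k - 2" by auto
    then show "cscale (\<beta> k) (V (bvec (i + k - 2)) (bvec 1)) = cscale (\<beta> k) (bvec (i + 1 + k - 2))"
      by (metis i1)
  qed simp
  have Sj: "V (S i) (bvec j) = 0" if "i \<ge> 2" "j \<ge> 2" for i j
    unfolding S_def V_simps using that by (intro sum.neutral) (auto simp: ij)
  define J where "J a b c = V a (V b c) + V b (V c a) + V c (V a b)" for a b c
  have cyc: "J a b c = J b c a" for a b c
    by (simp add: J_def ac_simps)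
  have alt: "J a b c = - J a c b" for a b c
    unfolding J_def by (simp only: sw[of c b] sw[of b a] sw[of a c] V_simps) simp
  have same: "J a b b = 0" for a b
  proof -
    have "V b b = 0" unfolding V_def by (rule table_bracket_self)
    then show ?thesis unfolding J_def by (simp add: V_simps sw[of b a])
  qed
  have J1: "J (bvec i) (bvec 1) (bvec 0) = 0" if "i \<ge> 2" for i
  proof -
    have "V (bvec i) (V (bvec 1) (bvec 0)) = cscale c (bvec (i + 1))"
      using that by (simp add: v10 V_simps i1 ij del: One_nat_def)
    moreover have "V (bvec 1) (V (bvec 0) (bvec i)) = cscale (\<mu> i) (bvec (i + 1)) + S (i + 1)"
      using that i1 S1
      by (simp add: sw[of "bvec 0" "bvec i"] sw[of "bvec 1" "bvec i"] sw[of "bvec 1" "S i"]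
          V_simps i0 del: One_nat_def)
    moreover have "V (bvec 0) (V (bvec i) (bvec 1)) = - (cscale (\<mu> i + c) (bvec (i + 1)) + S (i + 1))"
      using that i0[of "i + 1"]
      by (simp only: i1 sw[of "bvec 0" "bvec (i + 1)"] step)
    ultimately show ?thesis
      by (simp add: J_def cvs.scale_left_distrib)
  qed
  have J2: "J (bvec i) (bvec j) (bvec k) = 0" if "i \<ge> 2" "j \<ge> 2" for i j k
  proof -
    consider "k = 0" | "k = 1" | "k \<ge> 2" by linarith
    then show ?thesis
    proof cases
      case 1
      have a: "V (bvec i) (S j) = 0" "V (bvec j) (S i) = 0"
        using that by (subst sw, simp add: Sj)+
      have "V (bvec 0) (bvec i) = - (cscale (\<mu> i) (bvec i) + S i)"
        using that by (subst sw) (simp add: i0)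
      with 1 that a show ?thesis by (simp add: J_def V_simps i0 ij)
    next
      case 2
      have "V (bvec 1) (bvec i) = - bvec (i + 1)"
        using that by (subst sw) (simp add: i1 del: One_nat_def)
      with 2 that show ?thesis by (simp add: J_def V_simps i1 ij del: One_nat_def)
    next
      case 3
      with that show ?thesis by (simp add: J_def V_simps ij)
    qed
  qed
  have "J (bvec i) (bvec j) (bvec k) = 0" for i j k
  proof -
    consider "i \<ge> 2" "j \<ge> 2" | "j \<ge> 2" "k \<ge> 2" | "k \<ge> 2" "i \<ge> 2"
      | "i < 2" "j < 2" | "j < 2" "k < 2" | "k < 2" "i < 2" by linarith
    moreover have J3: "J (bvec i) (bvec j) (bvec k) = 0" if "j < 2" "k < 2" for i j k
    proof (cases "j = k")
      case True then show ?thesis by (simp add: same)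
    next
      case False
      with that have jk: "j = 1 \<and> k = 0 \<or> j = 0 \<and> k = 1" by linarith
      show ?thesis
      proof (cases "i \<ge> 2")
        case True with jk J1[of i] alt show ?thesis by (metis neg_equal_0_iff_equal)
      next
        case False
        with jk have "i = j \<or> i = k" by linarith
        then show ?thesis by (metis same cyc)
      qed
    qed
    ultimately show ?thesis by cases (metis J2 J3 cyc)+
  qed
  then show "table_bracket L (bvec i) (table_bracket L (bvec j) (bvec k))
      + table_bracket L (bvec j) (table_bracket L (bvec k) (bvec i))
      + table_bracket L (bvec k) (table_bracket L (bvec i) (bvec j)) = 0" for i j k
    unfolding J_def V_def .
qed

lemma lie_algebra_R1: "lie_algebra cscale (R1_bracket t \<beta>)"
  by (rule lie_algebra_general_table[where c = 1 and \<alpha> = 0 and \<mu> = "\<lambda>i. of_nat i - 2"])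
    (auto simp: R1_table_def fun_eq_iff)

lemma lie_algebra_R2: "lie_algebra cscale (R2_bracket t \<alpha>2 \<beta>)"
  by (rule lie_algebra_general_table
      [where c = 1 and \<alpha> = \<alpha>2 and \<mu> = "\<lambda>i. (of_nat i - 2) + \<beta> 2"])
    (auto simp: R2_table_def fun_eq_iff)

lemma lie_algebra_R3: "lie_algebra cscale (R3_bracket t \<beta>)"
  by (rule lie_algebra_general_table[where c = 0 and \<alpha> = 0 and \<mu> = "\<lambda>i. 1"])
    (auto simp: R3_table_def fun_eq_iff)

end

theory Submission
  imports Defs
begin

text \<open>
  All three families have the same shape: \<open>e\<^sub>1\<close> shifts the commuting vectors
  \<open>e\<^sub>2, e\<^sub>3, \<dots>\<close>, and \<open>x\<close> acts on them by \<open>e\<^sub>i \<mapsto> \<mu>\<^sub>i e\<^sub>i + S\<^sub>i\<close>, where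
  \<open>S\<^sub>i = \<Sum>\<^sub>k \<beta>\<^sub>k e\<^sub>i\<^sub>+\<^sub>k\<^sub>-\<^sub>2\<close>, while \<open>[e\<^sub>1, x] = c e\<^sub>1 + \<alpha> e\<^sub>2\<close>.  Likewise all four maps have
  the shape \<open>e\<^sub>i \<mapsto> \<delta> e\<^sub>i\<^sub>+\<^sub>s\<close> for \<open>i \<ge> 2\<close>, \<open>e\<^sub>1 \<mapsto> \<gamma> e\<^sub>2\<close>,
  \<open>x \<mapsto> \<gamma> \<Sum>\<^sub>j \<beta>\<^sub>j\<^sub>+\<^sub>1 e\<^sub>j\<close>.

  Such a map is a derivation for the following reasons.  A shift commutes with the actions of
  \<open>e\<^sub>1\<close> and \<open>x\<close> on \<open>e\<^sub>2, e\<^sub>3, \<dots>\<close> as soon as \<open>\<mu>\<close> is invariant under it.  The value at \<open>x\<close> is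
  chosen such that \<open>[e\<^sub>1, d x] = - \<gamma> S\<^sub>2\<close>, which cancels the tail of \<open>[d e\<^sub>1, x] = \<gamma> [e\<^sub>2, x]\<close>;
  the only condition left by the product \<open>[e\<^sub>1, x]\<close> is
  \<open>c \<gamma> e\<^sub>2 + \<alpha> \<delta> e\<^sub>2\<^sub>+\<^sub>s = \<gamma> \<mu>\<^sub>2 e\<^sub>2\<close> (\<open>derivation_shift_map\<close>).

  It is outer because an inner derivation \<open>b \<mapsto> [a, b]\<close> leaves little freedom: the coordinates of
  \<open>[a, e\<^sub>1]\<close> at \<open>e\<^sub>1, e\<^sub>2\<close> and those of \<open>[a, e\<^sub>2]\<close> away from \<open>e\<^sub>3\<close> are all fixed multiples
  of the \<open>x\<close>-coordinate of \<open>a\<close>.  In each case one of them vanishes although its factor does not,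
  which makes the \<open>x\<close>-coordinate zero, and another one is nonzero, a contradiction
  (\<open>outer_derivation_shift_table\<close>).
\<close>

section \<open>Brackets given on a basis\<close>

text \<open>Both sides of the product rule are bilinear and antisymmetric, so one order of each pair
  of distinct basis vectors decides.\<close>

lemma derivation_table_bracketI:
  assumes lie: "lie_algebra cscale (table_bracket L)"
    and lin: "Vector_Spaces.linear cscale cscale d"
    and basis: "\<And>i j. j < i \<Longrightarrow> d (table_bracket L (bvec i) (bvec j)) =
      table_bracket L (d (bvec i)) (bvec j) + table_bracket L (bvec i) (d (bvec j))"
  shows "lie_algebra.derivation cscale (table_bracket L) d"
proof -
  interpret d: Vector_Spaces.linear cscale cscale d by (rule lin)
  define V where "V = table_bracket L"
  note V_simps = table_bracket_simps[of L, folded V_def]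
  have sw: "V u v = - V v u" for u v unfolding V_def by (rule table_bracket_swap)
  have self: "V u u = 0" for u unfolding V_def by (rule table_bracket_self)
  define D where "D u v = d (V u v) - V (d u) v - V u (d v)" for u v
  have D_left: "Vector_Spaces.linear cscale cscale (\<lambda>u. D u v)" for v
    by (auto simp: D_def Vector_Spaces.linear_iff vector_space_cscale V_simps d.add d.scale
        cvs.scale_right_diff_distrib)
  have D_right: "Vector_Spaces.linear cscale cscale (\<lambda>v. D u v)" for u
    by (auto simp: D_def Vector_Spaces.linear_iff vector_space_cscale V_simps d.add d.scale
        cvs.scale_right_diff_distrib)
  have D_swap: "D u v = - D v u" for u v
    unfolding D_def by (subst (1 2 3) sw) (simp add: d.neg)
  have "D (bvec i) (bvec j) = 0" for i j
  proof (cases i j rule: linorder_cases)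
    case less
    then show ?thesis using basis[of i j] by (subst D_swap) (simp add: D_def V_def)
  next
    case equal
    then show ?thesis by (simp add: D_def self d.zero sw[of "d (bvec j)"])
  next
    case greater
    then show ?thesis using basis[of j i] by (simp add: D_def V_def)
  qed
  then have "D (bvec i) v = 0" for i v by (rule linear_eq_0[OF D_right])
  then have "D u v = 0" for u v by (rule linear_eq_0[OF D_left])
  then show ?thesis
    by (simp add: lie_algebra.derivation_def[OF lie] lin D_def V_def algebra_simps)
qed

lemma lookup_table_bracket_bvec_single:
  assumes "\<And>i. i \<noteq> m \<Longrightarrow> Poly_Mapping.lookup (table_bracket L (bvec i) (bvec j)) k = 0"
  shows "Poly_Mapping.lookup (table_bracket L a (bvec j)) k =
    Poly_Mapping.lookup a m * Poly_Mapping.lookup (table_bracket L (bvec m) (bvec j)) k"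
proof -
  let ?V = "\<lambda>i. table_bracket L (bvec i) (bvec j)"
  have "table_bracket L a (bvec j) = linear_extension ?V a"
    by (simp add: table_bracket_def)
  also have "\<dots> = (\<Sum>i\<in>insert m (Poly_Mapping.keys a). cscale (Poly_Mapping.lookup a i) (?V i))"
    by (rule linear_extension_superset) auto
  finally have "Poly_Mapping.lookup (table_bracket L a (bvec j)) k =
      (\<Sum>i\<in>insert m (Poly_Mapping.keys a).
        Poly_Mapping.lookup a i * Poly_Mapping.lookup (?V i) k)"
    by (simp add: lookup_sum)
  also have "\<dots> = (\<Sum>i\<in>{m}. Poly_Mapping.lookup a i * Poly_Mapping.lookup (?V i) k)"
    by (rule sum.mono_neutral_right) (use assms in auto)
  finally show ?thesis by simp
qed

section \<open>The common form of the algebras and of the maps\<close>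

definition shift_tail :: "nat \<Rightarrow> (nat \<Rightarrow> complex) \<Rightarrow> nat \<Rightarrow> vec" where
  "shift_tail t \<beta> i = (\<Sum>k = 3..t. cscale (\<beta> k) (bvec (i + k - 2)))"

definition shift_table ::
  "complex \<Rightarrow> complex \<Rightarrow> (nat \<Rightarrow> complex) \<Rightarrow> nat \<Rightarrow> (nat \<Rightarrow> complex) \<Rightarrow> nat \<Rightarrow> nat \<Rightarrow> vec" where
  "shift_table c \<alpha> \<mu> t \<beta> i j =
     (if i \<ge> 2 \<and> j = 1 then bvec (i + 1)
      else if i = 1 \<and> j = 0 then cscale c (bvec 1) + cscale \<alpha> (bvec 2)
      else if i \<ge> 2 \<and> j = 0 then cscale (\<mu> i) (bvec i) + shift_tail t \<beta> i
      else 0)"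

definition shift_map ::
  "complex \<Rightarrow> complex \<Rightarrow> nat \<Rightarrow> nat \<Rightarrow> (nat \<Rightarrow> complex) \<Rightarrow> vec \<Rightarrow> vec" where
  "shift_map \<gamma> \<delta> s t \<beta> = linear_extension (\<lambda>i.
     if i = 1 then cscale \<gamma> (bvec 2)
     else if i \<ge> 2 then cscale \<delta> (bvec (i + s))
     else cscale \<gamma> (\<Sum>j = 2..t - 1. cscale (\<beta> (j + 1)) (bvec j)))"

lemma R1_table_eq: "R1_table t \<beta> = shift_table 1 0 (\<lambda>i. of_nat i - 2) t \<beta>"
  by (auto simp: R1_table_def shift_table_def shift_tail_def fun_eq_iff)

lemma R2_table_eq: "R2_table t \<alpha> \<beta> = shift_table 1 \<alpha> (\<lambda>i. (of_nat i - 2) + \<beta> 2) t \<beta>"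
  by (auto simp: R2_table_def shift_table_def shift_tail_def fun_eq_iff)

lemma R3_table_eq: "R3_table t \<beta> = shift_table 0 0 (\<lambda>i. 1) t \<beta>"
  by (auto simp: R3_table_def shift_table_def shift_tail_def fun_eq_iff)

lemma lookup_bvec: "Poly_Mapping.lookup (bvec i) k = (if i = k then 1 else 0)"
  by (simp add: bvec_def lookup_single when_def)

lemma lookup_shift_tail_le: "k \<le> i \<Longrightarrow> Poly_Mapping.lookup (shift_tail t \<beta> i) k = 0"
  by (auto simp: shift_tail_def lookup_sum lookup_bvec intro!: sum.neutral)

lemma shift_table_bvec:
  fixes c \<alpha> \<mu> t \<beta>
  defines "V \<equiv> table_bracket (shift_table c \<alpha> \<mu> t \<beta>)"
  shows "i \<ge> 2 \<Longrightarrow> V (bvec i) (bvec 1) = bvec (i + 1)"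
    and "V (bvec 1) (bvec 0) = cscale c (bvec 1) + cscale \<alpha> (bvec 2)"
    and "i \<ge> 2 \<Longrightarrow> V (bvec i) (bvec 0) = cscale (\<mu> i) (bvec i) + shift_tail t \<beta> i"
    and "i \<ge> 2 \<Longrightarrow> j \<ge> 2 \<Longrightarrow> V (bvec i) (bvec j) = 0"
  by (auto simp: V_def table_bracket_bvec shift_table_def)

section \<open>The maps are derivations\<close>

lemma derivation_shift_map:
  assumes lie: "lie_algebra cscale (table_bracket (shift_table c \<alpha> \<mu> t \<beta>))"
    and \<mu>: "\<And>i. i \<ge> 2 \<Longrightarrow> \<delta> \<noteq> 0 \<Longrightarrow> \<mu> (i + s) = \<mu> i"
    and compat: "cscale (c * \<gamma>) (bvec 2) + cscale (\<alpha> * \<delta>) (bvec (2 + s)) =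
      cscale (\<gamma> * \<mu> 2) (bvec 2)"
  shows "lie_algebra.derivation cscale (table_bracket (shift_table c \<alpha> \<mu> t \<beta>))
    (shift_map \<gamma> \<delta> s t \<beta>)"
proof (rule derivation_table_bracketI[OF lie])
  define V where "V = table_bracket (shift_table c \<alpha> \<mu> t \<beta>)"
  define d where "d = shift_map \<gamma> \<delta> s t \<beta>"
  define X where "X = (\<Sum>j = 2..t - 1. cscale (\<beta> (j + 1)) (bvec j))"
  note V_simps = table_bracket_simps[of "shift_table c \<alpha> \<mu> t \<beta>", folded V_def]
  note V_bvec = shift_table_bvec[where c = c and \<alpha> = \<alpha> and \<mu> = \<mu> and t = t and \<beta> = \<beta>, folded V_def]
  show lin: "Vector_Spaces.linear cscale cscale (shift_map \<gamma> \<delta> s t \<beta>)"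
    unfolding shift_map_def by (rule linear_linear_extension)
  interpret d: Vector_Spaces.linear cscale cscale d unfolding d_def by (rule lin)
  have d0: "d (bvec 0) = cscale \<gamma> X" and d1: "d (bvec 1) = cscale \<gamma> (bvec 2)"
    and di: "\<And>i. i \<ge> 2 \<Longrightarrow> d (bvec i) = cscale \<delta> (bvec (i + s))"
    by (auto simp: d_def shift_map_def X_def)
  have d_tail: "d (shift_tail t \<beta> i) = cscale \<delta> (shift_tail t \<beta> (i + s))" if "i \<ge> 2" for i
    using that unfolding shift_tail_def d.sum d.scale cvs.scale_sum_right
    by (intro sum.cong) (auto simp: di mult.commute add.commute add.left_commute)
  \<comment> \<open>\<open>X\<close> is \<open>S\<^sub>2\<close> moved down by one step, and \<open>e\<^sub>1\<close> moves it up again.\<close>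
  have X1: "V X (bvec 1) = shift_tail t \<beta> 2"
  proof -
    have "V X (bvec 1) = (\<Sum>j = 2..t - 1. cscale (\<beta> (j + 1)) (bvec (j + 1)))"
      unfolding X_def V_simps by (intro sum.cong) (auto simp: V_bvec simp del: One_nat_def)
    also have "\<dots> = (\<Sum>k = 3..t. cscale (\<beta> k) (bvec k))"
      by (rule sum.reindex_bij_witness[of _ "\<lambda>k. k - 1" "\<lambda>j. j + 1"]) auto
    finally show ?thesis by (simp add: shift_tail_def)
  qed
  have Xi: "V (bvec i) X = 0" if "i \<ge> 2" for i
    unfolding X_def V_simps using that by (intro sum.neutral) (auto simp: V_bvec)
  fix i j :: nat assume "j < i"
  then consider "i \<ge> 2" "j \<ge> 2" | "i \<ge> 2" "j = 1" | "i \<ge> 2" "j = 0" | "i = 1" "j = 0" by linarith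
  then have "d (V (bvec i) (bvec j)) = V (d (bvec i)) (bvec j) + V (bvec i) (d (bvec j))"
  proof cases
    case 1
    then show ?thesis by (simp add: di V_simps V_bvec d.zero)
  next
    case 2
    then show ?thesis
      by (simp add: di d1 V_simps V_bvec del: One_nat_def) (simp add: add.commute add.left_commute)
  next
    case 3
    then show ?thesis
      using \<mu>[of i]
      by (cases "\<delta> = 0") (auto simp: di d0 d_tail Xi V_simps V_bvec d.add d.scale
          cvs.scale_right_distrib mult.commute)
  next
    case 4
    have swap: "V (bvec 1) X = - shift_tail t \<beta> 2"
      unfolding V_def by (subst table_bracket_swap) (simp only: X1[unfolded V_def])
    have "d (V (bvec 1) (bvec 0)) = cscale (c * \<gamma>) (bvec 2) + cscale (\<alpha> * \<delta>) (bvec (2 + s))"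
      by (simp add: V_bvec d.add d.scale d1 di del: One_nat_def)
    also have "\<dots> = cscale \<gamma> (V (bvec 2) (bvec 0)) + cscale \<gamma> (V (bvec 1) X)"
      unfolding compat by (simp add: V_bvec swap cvs.scale_right_distrib del: One_nat_def)
    finally show ?thesis
      using 4 by (simp add: d0 d1 V_simps del: One_nat_def)
  qed
  then show "shift_map \<gamma> \<delta> s t \<beta> (table_bracket (shift_table c \<alpha> \<mu> t \<beta>) (bvec i) (bvec j)) =
      table_bracket (shift_table c \<alpha> \<mu> t \<beta>) (shift_map \<gamma> \<delta> s t \<beta> (bvec i)) (bvec j) +
      table_bracket (shift_table c \<alpha> \<mu> t \<beta>) (bvec i) (shift_map \<gamma> \<delta> s t \<beta> (bvec j))"
    unfolding V_def d_def .
qed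

section \<open>The maps are not inner\<close>

text \<open>The coordinates used here cannot see \<open>a\<^sub>1\<close>, \<open>a\<^sub>2\<close>, \dots, because among the products of basis
  vectors with \<open>e\<^sub>1\<close> or \<open>e\<^sub>2\<close> only those with \<open>x\<close> contribute to them: \<open>[e\<^sub>i, e\<^sub>1] = e\<^sub>i\<^sub>+\<^sub>1\<close>
  with \<open>i \<ge> 2\<close> starts at \<open>e\<^sub>3\<close>, and \<open>[e\<^sub>1, e\<^sub>2] = - e\<^sub>3\<close>.  Either alternative of the third hypothesis forces the
  \<open>x\<close>-coordinate of \<open>a\<close> to vanish, and the last one contradicts this.\<close>

lemma outer_derivation_shift_table:
  assumes lie: "lie_algebra cscale (table_bracket (shift_table c \<alpha> \<mu> t \<beta>))"
    and der: "lie_algebra.derivation cscale (table_bracket (shift_table c \<alpha> \<mu> t \<beta>)) d"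
    and zero: "c \<noteq> 0 \<and> Poly_Mapping.lookup (d (bvec 1)) 1 = 0 \<or>
      \<mu> 2 \<noteq> 0 \<and> Poly_Mapping.lookup (d (bvec 2)) 2 = 0"
    and nonzero: "Poly_Mapping.lookup (d (bvec 1)) 2 \<noteq> 0 \<or>
      (\<exists>k. k \<noteq> 3 \<and> Poly_Mapping.lookup (d (bvec 2)) k \<noteq> 0)"
  shows "lie_algebra.outer_derivation cscale (table_bracket (shift_table c \<alpha> \<mu> t \<beta>)) d"
proof -
  let ?L = "shift_table c \<alpha> \<mu> t \<beta>"
  have False if inner: "\<And>b. d b = table_bracket ?L a b" for a
  proof -
    have e1: "Poly_Mapping.lookup (d (bvec 1)) k =
        Poly_Mapping.lookup a 0 * - Poly_Mapping.lookup (?L 1 0) k" if "k \<in> {1, 2}" for k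
      unfolding inner
      by (subst lookup_table_bracket_bvec_single[where m = 0])
        (use that in \<open>auto simp: table_bracket_bvec shift_table_def lookup_bvec lookup_minus lookup_add\<close>)
    have e2: "Poly_Mapping.lookup (d (bvec 2)) k =
        Poly_Mapping.lookup a 0 * - Poly_Mapping.lookup (?L 2 0) k" if "k \<noteq> 3" for k
      unfolding inner
      by (subst lookup_table_bracket_bvec_single[where m = 0])
        (use that in \<open>auto simp: table_bracket_bvec shift_table_def lookup_bvec lookup_minus lookup_add\<close>)
    have "Poly_Mapping.lookup (?L 1 0) 1 = c" "Poly_Mapping.lookup (?L 2 0) 2 = \<mu> 2"
      by (simp_all add: shift_table_def lookup_add lookup_bvec lookup_shift_tail_le)
    with zero e1[of 1] e2[of 2] have "Poly_Mapping.lookup a 0 = 0" by auto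
    with nonzero e1[of 2] e2 show False by auto
  qed
  with der show ?thesis
    by (auto simp: lie_algebra.outer_derivation_def[OF lie] lie_algebra.inner_derivation_def[OF lie])
qed

section \<open>The four outer derivations\<close>

lemma outer_R1:
  "lie_algebra.outer_derivation cscale (R1_bracket t \<beta>) (shift_map 0 1 0 t \<beta>)"
  unfolding R1_table_eq
  by (intro outer_derivation_shift_table derivation_shift_map lie_algebra_R1[unfolded R1_table_eq])
    (auto simp: shift_map_def lookup_bvec)

lemma outer_R2_eq:
  assumes "\<beta> 2 = 1"
  shows "lie_algebra.outer_derivation cscale (R2_bracket t \<alpha> \<beta>) (shift_map 1 0 s t \<beta>)"
  unfolding R2_table_eq
  by (intro outer_derivation_shift_table derivation_shift_map lie_algebra_R2[unfolded R2_table_eq])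
    (use assms in \<open>auto simp: shift_map_def lookup_bvec\<close>)

text \<open>The coefficient \<open>\<gamma> = \<alpha> / (\<beta>\<^sub>2 - 1)\<close> is the solution of \<open>\<gamma> + \<alpha> = \<gamma> \<beta>\<^sub>2\<close>, which is the
  compatibility condition for the product \<open>[e\<^sub>1, x]\<close>.\<close>

lemma outer_R2_neq:
  assumes "\<beta> 2 \<noteq> 1"
  shows "lie_algebra.outer_derivation cscale (R2_bracket t \<alpha> \<beta>)
    (shift_map (\<alpha> / (\<beta> 2 - 1)) 1 0 t \<beta>)"
proof -
  have "\<alpha> / (\<beta> 2 - 1) + \<alpha> = \<alpha> / (\<beta> 2 - 1) * \<beta> 2"
    using assms by (simp add: field_simps)
  then show ?thesis
    unfolding R2_table_eq
    by (intro outer_derivation_shift_table derivation_shift_map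
        lie_algebra_R2[unfolded R2_table_eq])
      (auto simp: shift_map_def lookup_bvec cvs.scale_left_distrib[symmetric])
qed

lemma outer_R3:
  "lie_algebra.outer_derivation cscale (R3_bracket t \<beta>) (shift_map 0 1 2 t \<beta>)"
  unfolding R3_table_eq
  by (intro outer_derivation_shift_table derivation_shift_map lie_algebra_R3[unfolded R3_table_eq])
    (auto simp: shift_map_def lookup_bvec intro!: exI[of _ 4])

theorem proposition3p2:
  fixes t :: nat and \<beta> :: "nat \<Rightarrow> complex" and \<alpha>2 :: complex
  shows
    "lie_algebra.outer_derivation cscale (R1_bracket t \<beta>)
       (linear_extension (\<lambda>i. if i \<ge> 2 then bvec i else 0))
     \<and>
     (\<beta> 2 = 1 \<longrightarrow>
      lie_algebra.outer_derivation cscale (R2_bracket t \<alpha>2 \<beta>)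
        (linear_extension (\<lambda>i.
           if i = 1 then bvec 2
           else if i = 0 then (\<Sum>j = 2..t - 1. cscale (\<beta> (j + 1)) (bvec j))
           else 0)))
     \<and>
     (\<beta> 2 \<noteq> 1 \<longrightarrow>
      lie_algebra.outer_derivation cscale (R2_bracket t \<alpha>2 \<beta>)
        (linear_extension (\<lambda>i.
           if i = 1 then cscale (\<alpha>2 / (\<beta> 2 - 1)) (bvec 2)
           else if i \<ge> 2 then bvec i
           else (\<Sum>j = 2..t - 1. cscale (\<alpha>2 * \<beta> (j + 1) / (\<beta> 2 - 1)) (bvec j)))))
     \<and>
     lie_algebra.outer_derivation cscale (R3_bracket t \<beta>)
       (linear_extension (\<lambda>i. if i \<ge> 2 then bvec (i + 2) else 0))"
proof -
  have *: "linear_extension \<phi> = shift_map \<gamma> \<delta> s t \<beta>"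
    if "\<phi> 0 = cscale \<gamma> (\<Sum>j = 2..t - 1. cscale (\<beta> (j + 1)) (bvec j))"
      "\<phi> 1 = cscale \<gamma> (bvec 2)" "\<And>i. i \<ge> 2 \<Longrightarrow> \<phi> i = cscale \<delta> (bvec (i + s))" for \<phi> \<gamma> \<delta> s
  proof -
    have "\<phi> i = (if i = 1 then cscale \<gamma> (bvec 2)
        else if i \<ge> 2 then cscale \<delta> (bvec (i + s))
        else cscale \<gamma> (\<Sum>j = 2..t - 1. cscale (\<beta> (j + 1)) (bvec j)))" for i
    proof -
      consider "i = 0" | "i = 1" | "i \<ge> 2" by linarith
      then show ?thesis
        by cases (use that in simp_all)
    qed
    then show ?thesis unfolding shift_map_def by presburger
  qed
  have 1: "linear_extension (\<lambda>i. if i \<ge> 2 then bvec i else 0) = shift_map 0 1 0 t \<beta>"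
    by (rule *) auto
  have 2: "linear_extension (\<lambda>i. if i = 1 then bvec 2
        else if i = 0 then (\<Sum>j = 2..t - 1. cscale (\<beta> (j + 1)) (bvec j)) else 0) =
      shift_map 1 0 0 t \<beta>"
    by (rule *) auto
  have 3: "linear_extension (\<lambda>i. if i = 1 then cscale (\<alpha>2 / (\<beta> 2 - 1)) (bvec 2)
        else if i \<ge> 2 then bvec i
        else (\<Sum>j = 2..t - 1. cscale (\<alpha>2 * \<beta> (j + 1) / (\<beta> 2 - 1)) (bvec j))) =
      shift_map (\<alpha>2 / (\<beta> 2 - 1)) 1 0 t \<beta>"
    by (rule *) (auto simp: cvs.scale_sum_right)
  have 4: "linear_extension (\<lambda>i. if i \<ge> 2 then bvec (i + 2) else 0) = shift_map 0 1 2 t \<beta>"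
    by (rule *) auto
  show ?thesis
    unfolding 1 2 3 4 using outer_R1 outer_R2_eq outer_R2_neq outer_R3 by blast
qed

end
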